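(* Let $T$ be a Leech tree of order $n$ with vertex set $V$, and let $F$ be a valid prefix forest on $V$ that is a weighted subforest of $T$ (every exposed edge of $F$ is an edge of $T$ and has the same weight in $F$ and in $T$). Let $K_1,\ldots,K_m$ be the components of $F$, and let $H$ be its set of unfilled values. Then for every unordered component pair $i<j$ there are ports $p_{ij}\in K_i$ and $p_{ji}\in K_j$ and a positive integral route contribution $L_{ij}\ge 1$ such that the component-pair block $$B_{ij}=\bigl\{\,d_i(x,p_{ij})+L_{ij}+d_j(p_{ji},y): x\in K_i,\ y\in K_j\,\bigr\}$$ satisfies all of the following: (i) $|B_{ij}|=|K_i||K_j|$ for all $i<j$; (ii) $B_{ij}\subseteq H$ for all $i<j$; (iii) the blocks $B_{ij}$ $(i<j)$ are pairwise disjoint; (iv) $\bigcup_{i<j}B_{ij}=H$.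
   Context: A Leech tree of order $n$ is a finite simple tree $T=(V,E,w)$ with $|V|=n$ and positive integer edge weights such that the weighted distances $d_T(x,y)$ (sum of edge weights on the unique $x$--$y$ path), indexed by unordered pairs of distinct vertices, are exactly $1,2,\ldots,N$, each once, where $N=\binom n2$. Put $I_N=\{1,\ldots,N\}$. A (weighted) prefix forest on $V$ is a forest with vertex set $V$ and positive integer edge weights; its edges are called exposed, and vertices incident with no exposed edge are singleton components. For a component $K_i$ and $x,y\in K_i$, $d_i(x,y)$ denotes the weighted distance inside $K_i$. An internal prefix distance is a value $d_i(x,y)$ with $x\ne y$ in the same component $K_i$; $D$ denotes the set of all internal prefix distances over all components. The prefix forest is valid if all its internal distances, indexed by unordered pairs of distinct vertices in a common component and taken together over all components, are pairwise distinct and lie in $I_N$. The set of unfilled values is $H=I_N\setminus D$. The port $p_{ij}$ of $K_i$ toward $K_j$ is the vertex of $K_i$ at which the path in $T$ toward $K_j$ leaves $K_i$ (that is, the endpoint in $K_i$ of the unique shortest subpath of $T$ joining $K_i$ and $K_j$). The route contribution $L_{ij}$ is the weighted length in $T$ of the portion of that path from $p_{ij}$ to $p_{ji}$. Indices $i<j$ range over $1\le i<j\le m$. *)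

theory Defs
  imports Main "HOL-Library.Disjoint_Sets"
begin

section \<open>Finite simple graphs with positive integer edge weights\<close>

text \<open>
  An edge is the two-element set of its endpoints, so graphs are undirected, loopless and
  without parallel edges. (The digraphs of \<open>Graph_Theory\<close> do not fit: a symmetric digraph with
  an arc has a directed cycle of length two, hence is never a \<open>forest\<close> there.)
  The value of \<open>weight\<close> outside \<open>edges\<close> is irrelevant.
\<close>

record 'a wgraph =
  verts :: "'a set"
  edges :: "'a set set"
  weight :: "'a set \<Rightarrow> nat"

definition wf_wgraph :: "'a wgraph \<Rightarrow> bool" where
  "wf_wgraph G \<longleftrightarrow>
     finite (verts G) \<and>
     (\<forall>e\<in>edges G. e \<subseteq> verts G \<and> card e = 2) \<and>
     (\<forall>e\<in>edges G. weight G e > 0)"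

definition is_path :: "'a wgraph \<Rightarrow> 'a list \<Rightarrow> bool" where
  "is_path G ps \<longleftrightarrow>
     ps \<noteq> [] \<and> set ps \<subseteq> verts G \<and> distinct ps \<and>
     (\<forall>k. Suc k < length ps \<longrightarrow> {ps ! k, ps ! Suc k} \<in> edges G)"

definition is_path_betw :: "'a wgraph \<Rightarrow> 'a \<Rightarrow> 'a list \<Rightarrow> 'a \<Rightarrow> bool" where
  "is_path_betw G x ps y \<longleftrightarrow> is_path G ps \<and> hd ps = x \<and> last ps = y"

definition path_weight :: "'a wgraph \<Rightarrow> 'a list \<Rightarrow> nat" where
  "path_weight G ps = (\<Sum>k<length ps - 1. weight G {ps ! k, ps ! Suc k})"

definition is_cycle :: "'a wgraph \<Rightarrow> 'a list \<Rightarrow> bool" where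
  "is_cycle G ps \<longleftrightarrow> is_path G ps \<and> length ps \<ge> 3 \<and> {last ps, hd ps} \<in> edges G"

definition is_connected :: "'a wgraph \<Rightarrow> bool" where
  "is_connected G \<longleftrightarrow>
     verts G \<noteq> {} \<and> (\<forall>x\<in>verts G. \<forall>y\<in>verts G. \<exists>ps. is_path_betw G x ps y)"

definition is_forest :: "'a wgraph \<Rightarrow> bool" where
  "is_forest G \<longleftrightarrow> wf_wgraph G \<and> (\<nexists>ps. is_cycle G ps)"

definition is_tree :: "'a wgraph \<Rightarrow> bool" where
  "is_tree G \<longleftrightarrow> is_forest G \<and> is_connected G"

text \<open>Meaningful when there is exactly one path from \<open>x\<close> to \<open>y\<close>, as inside a component of a forest.\<close>

definition wdist :: "'a wgraph \<Rightarrow> 'a \<Rightarrow> 'a \<Rightarrow> nat" where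
  "wdist G x y = path_weight G (THE ps. is_path_betw G x ps y)"

definition components :: "'a wgraph \<Rightarrow> 'a set set" where
  "components G = {{y \<in> verts G. \<exists>ps. is_path_betw G x ps y} | x. x \<in> verts G}"

definition induced :: "'a wgraph \<Rightarrow> 'a set \<Rightarrow> 'a wgraph" where
  "induced G K = \<lparr>verts = K, edges = {e \<in> edges G. e \<subseteq> K}, weight = weight G\<rparr>"

definition weighted_subforest :: "'a wgraph \<Rightarrow> 'a wgraph \<Rightarrow> bool" where
  "weighted_subforest F T \<longleftrightarrow>
     verts F \<subseteq> verts T \<and> edges F \<subseteq> edges T \<and> (\<forall>e\<in>edges F. weight F e = weight T e)"


section \<open>Leech trees and prefix forests\<close>

definition value_range :: "nat \<Rightarrow> nat set" where
  "value_range n = {1..n choose 2}"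

definition leech_tree :: "nat \<Rightarrow> 'a wgraph \<Rightarrow> bool" where
  "leech_tree n T \<longleftrightarrow>
     is_tree T \<and> card (verts T) = n \<and>
     {wdist T x y | x y. x \<in> verts T \<and> y \<in> verts T \<and> x \<noteq> y} = value_range n \<and>
     (\<forall>x\<in>verts T. \<forall>y\<in>verts T. \<forall>x'\<in>verts T. \<forall>y'\<in>verts T.
        x \<noteq> y \<and> x' \<noteq> y' \<and> wdist T x y = wdist T x' y' \<longrightarrow> {x, y} = {x', y'})"

definition prefix_forest_on :: "'a set \<Rightarrow> 'a wgraph \<Rightarrow> bool" where
  "prefix_forest_on V F \<longleftrightarrow> is_forest F \<and> verts F = V"

definition comp_dist :: "'a wgraph \<Rightarrow> 'a set \<Rightarrow> 'a \<Rightarrow> 'a \<Rightarrow> nat" where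
  "comp_dist F K x y = wdist (induced F K) x y"

definition internal_distances :: "'a wgraph \<Rightarrow> nat set" where
  "internal_distances F =
     {comp_dist F K x y | K x y. K \<in> components F \<and> x \<in> K \<and> y \<in> K \<and> x \<noteq> y}"

definition valid_prefix_forest_on :: "'a set \<Rightarrow> 'a wgraph \<Rightarrow> bool" where
  "valid_prefix_forest_on V F \<longleftrightarrow>
     prefix_forest_on V F \<and>
     internal_distances F \<subseteq> value_range (card V) \<and>
     (\<forall>K\<in>components F. \<forall>x\<in>K. \<forall>y\<in>K. \<forall>K'\<in>components F. \<forall>x'\<in>K'. \<forall>y'\<in>K'.
        x \<noteq> y \<and> x' \<noteq> y' \<and> comp_dist F K x y = comp_dist F K' x' y' \<longrightarrow> {x, y} = {x', y'})"

definition unfilled :: "'a wgraph \<Rightarrow> nat set" where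
  "unfilled F = value_range (card (verts F)) - internal_distances F"


section \<open>Ports and component-pair blocks\<close>

definition joining_path :: "'a wgraph \<Rightarrow> 'a set \<Rightarrow> 'a set \<Rightarrow> 'a list \<Rightarrow> bool" where
  "joining_path T A B ps \<longleftrightarrow> is_path T ps \<and> hd ps \<in> A \<and> last ps \<in> B"

definition shortest_joining_path :: "'a wgraph \<Rightarrow> 'a set \<Rightarrow> 'a set \<Rightarrow> 'a list \<Rightarrow> bool" where
  "shortest_joining_path T A B ps \<longleftrightarrow>
     joining_path T A B ps \<and> (\<forall>qs. joining_path T A B qs \<longrightarrow> path_weight T ps \<le> path_weight T qs)"

text \<open>The port of \<open>A\<close> toward \<open>B\<close>; uniqueness of the shortest joining path is part of the notion.\<close>

definition is_port :: "'a wgraph \<Rightarrow> 'a set \<Rightarrow> 'a set \<Rightarrow> 'a \<Rightarrow> bool" where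
  "is_port T A B p \<longleftrightarrow>
     (\<exists>!ps. shortest_joining_path T A B ps) \<and>
     (\<exists>ps. shortest_joining_path T A B ps \<and> hd ps = p)"

definition block :: "'a wgraph \<Rightarrow> 'a set \<Rightarrow> 'a set \<Rightarrow> 'a \<Rightarrow> nat \<Rightarrow> 'a \<Rightarrow> nat set" where
  "block F A B p l q = {comp_dist F A x p + l + comp_dist F B q y | x y. x \<in> A \<and> y \<in> B}"

end

(*
  Two components A and B of F are joined by a path of T that meets A only in its first vertex p
  and B only in its last vertex q.  Prepending the F-path from x to p and appending the F-path
  from q to y gives a path of T, hence by uniqueness the path from x to y, so
  d(x,y) = d(x,p) + d(p,q) + d(q,y).  Thus the block of a pair of components consists of the
  T-distances between them, and the Leech property, which identifies values with vertex pairs,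
  turns all four claims into the partition of vertex pairs according to their components.
*)
theory Submission
  imports Defs
begin

section \<open>Paths and their weights\<close>

text \<open>\<open>successively\<close> has rewrite rules for cons, append and \<open>rev\<close>,
  so cutting, gluing and reversing paths becomes simplification rather than index
  arithmetic.\<close>

lemma is_path_iff_successively:
  "is_path G ps \<longleftrightarrow>
     ps \<noteq> [] \<and> set ps \<subseteq> verts G \<and> distinct ps \<and> successively (\<lambda>a b. {a, b} \<in> edges G) ps"
  by (auto simp: is_path_def successively_conv_nth)

lemma is_path_appendD:
  assumes "is_path G (us @ z # vs)"
  shows "is_path G (us @ [z])" "is_path G (z # vs)"
  using assms by (auto simp: is_path_iff_successively successively_append_iff)

lemma is_path_rev [simp]: "is_path G (rev ps) \<longleftrightarrow> is_path G ps"
  by (auto simp: is_path_iff_successively insert_commute)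

lemma is_path_betw_rev: "is_path_betw G x ps y \<Longrightarrow> is_path_betw G y (rev ps) x"
  by (auto simp: is_path_betw_def hd_rev last_rev)

lemma is_path_betw_ends:
  assumes "is_path_betw G x ps y"
  shows "ps \<noteq> []" "x \<in> set ps" "y \<in> set ps" "set ps \<subseteq> verts G"
  using assms by (auto simp: is_path_betw_def is_path_def)

lemma is_path_betw_refl: "x \<in> verts G \<Longrightarrow> is_path_betw G x [x] x"
  by (simp add: is_path_betw_def is_path_def)

lemma path_weight_simps [simp]:
  "path_weight G [] = 0"
  "path_weight G [x] = 0"
  "path_weight G (x # y # ps) = weight G {x, y} + path_weight G (y # ps)"
  by (simp_all add: path_weight_def sum.lessThan_Suc_shift del: sum.lessThan_Suc)

text \<open>The cut vertex \<open>z\<close> is kept on both sides, so that the edge entering it and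
  the edge leaving it are each counted exactly once.\<close>

lemma path_weight_append:
  "path_weight G (us @ z # vs) = path_weight G (us @ [z]) + path_weight G (z # vs)"
proof (induction us)
  case (Cons u us)
  then show ?case by (cases us) auto
qed simp

lemma path_weight_rev [simp]: "path_weight G (rev ps) = path_weight G ps"
proof (induction ps rule: induct_list012)
  case (3 x y zs)
  then show ?case
    using path_weight_append[of G "rev zs" y "[x]"] by (simp add: insert_commute)
qed simp_all

lemma path_weight_pos:
  assumes "wf_wgraph G" "is_path_betw G x ps y" "x \<noteq> y"
  shows "path_weight G ps > 0"
proof -
  have ps: "is_path G ps" "hd ps = x" "last ps = y"
    using assms by (auto simp: is_path_betw_def)
  \<comment> \<open>\<open>remdups_adj.cases\<close> distinguishes lists of length zero, one and at
    least two; a single vertex would give \<open>x = y\<close>.\<close>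
  then obtain a b qs where "ps = a # b # qs"
    using assms(3) by (cases ps rule: remdups_adj.cases) (auto simp: is_path_def)
  moreover from this have "weight G {a, b} > 0"
    using ps assms(1) by (auto simp: is_path_iff_successively wf_wgraph_def)
  ultimately show ?thesis by simp
qed

text \<open>Meeting only in \<open>y\<close> keeps the concatenation free of repetitions;
  \<open>tl qs\<close> drops the second copy of \<open>y\<close>.\<close>

lemma is_path_betw_join:
  assumes "is_path_betw G x ps y" "is_path_betw G y qs z" "set ps \<inter> set qs \<subseteq> {y}"
  shows "is_path_betw G x (ps @ tl qs) z"
    and "path_weight G (ps @ tl qs) = path_weight G ps + path_weight G qs"
    and "set (ps @ tl qs) = set ps \<union> set qs"
proof -
  obtain us where us: "ps = us @ [y]"
    using assms(1) by (metis append_butlast_last_id is_path_betw_def is_path_def)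
  obtain vs where vs: "qs = y # vs"
    using assms(2) by (metis list.collapse is_path_betw_def is_path_def)
  show "is_path_betw G x (ps @ tl qs) z"
    using assms unfolding us vs
    by (auto simp: is_path_betw_def is_path_iff_successively successively_append_iff
        successively_Cons hd_append)
  show "path_weight G (ps @ tl qs) = path_weight G ps + path_weight G qs"
    using path_weight_append[of G us y vs] by (simp add: us vs)
  show "set (ps @ tl qs) = set ps \<union> set qs"
    by (auto simp: us vs)
qed

lemma is_path_betw_appendD:
  assumes "is_path_betw G x (us @ w # vs) y"
  shows "is_path_betw G x (us @ [w]) w" "is_path_betw G w (w # vs) y"
proof -
  have P: "is_path G (us @ w # vs)" "hd (us @ w # vs) = x" "last (us @ w # vs) = y"
    using assms by (auto simp: is_path_betw_def)
  have "hd (us @ [w]) = x"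
    using P(2) by (cases us) simp_all
  then show "is_path_betw G x (us @ [w]) w"
    using is_path_appendD(1)[OF P(1)] by (simp add: is_path_betw_def)
  show "is_path_betw G w (w # vs) y"
    using is_path_appendD(2)[OF P(1)] P(3) by (simp add: is_path_betw_def)
qed

text \<open>The two paths may cross several times. Following \<open>ps\<close> only up to its first
  vertex \<open>w\<close> on \<open>qs\<close> and then switching to \<open>qs\<close> leaves
  \<open>w\<close> as the sole common vertex of the two pieces.\<close>

lemma is_path_betw_trans:
  assumes "is_path_betw G x ps y" "is_path_betw G y qs z"
  shows "\<exists>rs. is_path_betw G x rs z"
proof -
  have "\<exists>w\<in>set ps. w \<in> set qs"
    using is_path_betw_ends(3)[OF assms(1)] is_path_betw_ends(2)[OF assms(2)] by blast
  then obtain us w vs where split: "ps = us @ w # vs" "w \<in> set qs" "\<forall>u\<in>set us. u \<notin> set qs"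
    using split_list_first_prop[of ps "\<lambda>w. w \<in> set qs"] by blast
  obtain us' vs' where qs: "qs = us' @ w # vs'"
    using split(2) by (meson split_list)
  have "is_path_betw G x (us @ [w]) w" "is_path_betw G w (w # vs') z"
    using is_path_betw_appendD(1)[OF assms(1)[unfolded split(1)]]
      is_path_betw_appendD(2)[OF assms(2)[unfolded qs]] .
  moreover have "set (us @ [w]) \<inter> set (w # vs') \<subseteq> {w}"
    using split(3) qs by auto
  ultimately show ?thesis
    by (meson is_path_betw_join(1))
qed

section \<open>Distances in trees\<close>

text \<open>Induction along the first path. Equal second vertices are handled by the induction
  hypothesis. If the second vertices differ, following one path to its first meeting with the other
  and returning along the other closes a cycle through \<open>x\<close>.\<close>

lemma forest_path_unique:
  assumes "is_forest G" "is_path_betw G x ps y" "is_path_betw G x qs y"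
  shows "ps = qs"
  using assms(2,3)
proof (induction ps arbitrary: x qs)
  case Nil
  then show ?case by (simp add: is_path_betw_def is_path_def)
next
  case (Cons x' ps)
  have x': "x' = x" using Cons.prems(1) by (simp add: is_path_betw_def)
  obtain qs' where qs: "qs = x # qs'"
    using Cons.prems(2) by (metis list.collapse is_path_betw_def is_path_def)
  have P: "is_path G (x # ps)" "last (x # ps) = y" and Q: "is_path G (x # qs')" "last (x # qs') = y"
    using Cons.prems by (auto simp: is_path_betw_def x' qs)
  show ?case
  proof (cases "x = y")
    case True
    \<comment> \<open>A repetition-free list whose first and last entries agree is a
      singleton.\<close>
    then have "ps = []" "qs' = []"
      using P Q by (auto simp: is_path_def split: if_splits)
    then show ?thesis by (simp add: x' qs)
  next
    case False
    then obtain a ps' b qs'' where ab: "ps = a # ps'" "qs' = b # qs''"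
      using P(2) Q(2) by (metis last.simps list.exhaust)
    have tails: "is_path_betw G a ps y" "is_path_betw G b qs' y"
      using P Q by (auto simp: is_path_betw_def is_path_iff_successively ab)
    show ?thesis
    proof (cases "a = b")
      case True
      then show ?thesis using Cons.IH[OF tails(1)] tails(2) by (simp add: x' qs)
    next
      case False
      \<comment> \<open>Both tails end in \<open>y\<close>, so they meet. The first meeting vertex
        \<open>z\<close> is taken, so that the outward piece avoids the return piece except at
        \<open>z\<close>.\<close>
      have "\<exists>z\<in>set ps. z \<in> set qs'"
        using is_path_betw_ends(3)[OF tails(1)] is_path_betw_ends(3)[OF tails(2)] by blast
      then obtain us z vs where us: "ps = us @ z # vs" "z \<in> set qs'" "\<forall>u\<in>set us. u \<notin> set qs'"
        using split_list_first_prop[of ps "\<lambda>z. z \<in> set qs'"] by blast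
      obtain us' vs' where us': "qs' = us' @ z # vs'"
        using us(2) by (meson split_list)
      have "is_path_betw G x ((x # us) @ z # vs) y"
        using P us(1) by (simp add: is_path_betw_def)
      from is_path_betw_appendD(1)[OF this] have there: "is_path_betw G x (x # us @ [z]) z"
        by simp
      have returning: "is_path_betw G z (rev (us' @ [z])) b"
        using is_path_betw_appendD(1)[OF tails(2)[unfolded us']] by (rule is_path_betw_rev)
      have "x \<notin> set qs'"
        using Q(1) by (simp add: is_path_def)
      then have "set (x # us @ [z]) \<inter> set (rev (us' @ [z])) \<subseteq> {z}"
        using us(3) us' by auto
      note path = is_path_betw_join(1)[OF there returning this]
      let ?c = "x # us @ z # rev us'"
      have c: "is_path_betw G x ?c b"
        using path by simp
      \<comment> \<open>If both were empty, \<open>z\<close> would equal \<open>a\<close> and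
        \<open>b\<close> at once. Hence the closed walk has a vertex besides \<open>x\<close> and
        \<open>z\<close>, as a cycle requires.\<close>
      have "us \<noteq> [] \<or> us' \<noteq> []"
        using False ab us(1) us' by auto
      then have "length ?c \<ge> 3"
        by (cases us; cases us') auto
      moreover have "{b, x} \<in> edges G"
        using Q(1) by (simp add: is_path_iff_successively ab insert_commute)
      ultimately have "is_cycle G ?c"
        using c by (simp add: is_cycle_def is_path_betw_def del: last.simps)
      then show ?thesis using assms(1) by (auto simp: is_forest_def)
    qed
  qed
qed

lemma wdist_eq_path_weight:
  assumes "is_forest G" "is_path_betw G x ps y"
  shows "wdist G x y = path_weight G ps"
proof -
  have "(THE ps. is_path_betw G x ps y) = ps"
    using assms(2) forest_path_unique[OF assms(1) _ assms(2)] by (rule the_equality)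
  then show ?thesis by (simp add: wdist_def)
qed

lemma wdist_commute:
  assumes "is_tree G" "x \<in> verts G" "y \<in> verts G"
  shows "wdist G x y = wdist G y x"
proof -
  obtain ps where "is_path_betw G x ps y"
    using assms by (auto simp: is_tree_def is_connected_def)
  then show ?thesis
    using wdist_eq_path_weight[of G] assms(1) is_path_betw_rev[of G x ps y]
    by (simp add: is_tree_def)
qed

section \<open>Components\<close>

text \<open>Reachability is symmetric by reversal and transitive by
  \<open>is_path_betw_trans\<close>, so any member can replace the base vertex from which the
  component was formed.\<close>

lemma component_eq:
  assumes "K \<in> components G" "x \<in> K"
  shows "K = {y. \<exists>ps. is_path_betw G x ps y}"
proof -
  obtain z where z: "K = {y \<in> verts G. \<exists>ps. is_path_betw G z ps y}"
    using assms(1) by (auto simp: components_def)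
  then obtain ps where ps: "is_path_betw G z ps x"
    using assms(2) by auto
  show ?thesis
  proof (intro set_eqI iffI)
    fix y assume "y \<in> K"
    then obtain qs where "is_path_betw G z qs y" using z by auto
    then show "y \<in> {y. \<exists>ps. is_path_betw G x ps y}"
      using is_path_betw_trans[OF is_path_betw_rev[OF ps]] by simp
  next
    fix y assume "y \<in> {y. \<exists>ps. is_path_betw G x ps y}"
    then obtain qs where qs: "is_path_betw G x qs y" by auto
    then have "y \<in> verts G" using is_path_betw_ends(3,4)[OF qs] by blast
    then show "y \<in> K" using is_path_betw_trans[OF ps qs] z by auto
  qed
qed

text \<open>Every vertex of the path ends an initial segment of it and is therefore reachable from
  \<open>x\<close>.\<close>

lemma component_path_subset:
  assumes "K \<in> components G" "x \<in> K" "is_path_betw G x ps y"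
  shows "set ps \<subseteq> K"
proof
  fix w assume "w \<in> set ps"
  then obtain us vs where "ps = us @ w # vs" by (meson split_list)
  then have "is_path_betw G x (us @ [w]) w"
    using assms(3) is_path_betw_appendD(1) by metis
  then show "w \<in> K"
    using component_eq[OF assms(1,2)] by blast
qed

lemma component_path:
  assumes "K \<in> components G" "x \<in> K" "y \<in> K"
  obtains ps where "is_path_betw G x ps y" "set ps \<subseteq> K"
proof -
  have "y \<in> {y. \<exists>ps. is_path_betw G x ps y}"
    using component_eq[OF assms(1,2)] assms(3) by simp
  then obtain ps where "is_path_betw G x ps y" by blast
  then show thesis
    using component_path_subset[OF assms(1,2)] by (intro that)
qed

lemma components_disjoint:
  assumes "K \<in> components G" "K' \<in> components G" "K \<noteq> K'"
  shows "K \<inter> K' = {}"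
proof -
  have "K = K'" if "x \<in> K" "x \<in> K'" for x
    using component_eq[OF assms(1) that(1)] component_eq[OF assms(2) that(2)] by simp
  then show ?thesis using assms(3) by auto
qed

lemma component_of_vertex:
  assumes "x \<in> verts G"
  shows "x \<in> {y \<in> verts G. \<exists>ps. is_path_betw G x ps y}"
  using assms is_path_betw_refl[OF assms] by auto

lemma component_nonempty: "K \<in> components G \<Longrightarrow> K \<noteq> {}"
  unfolding components_def using component_of_vertex[of _ G] by blast

lemma Union_components: "\<Union>(components G) = verts G"
proof
  show "\<Union>(components G) \<subseteq> verts G"
    by (auto simp: components_def)
  show "verts G \<subseteq> \<Union>(components G)"
  proof
    fix x assume "x \<in> verts G"
    then show "x \<in> \<Union>(components G)"
      unfolding components_def by (intro UnionI[OF _ component_of_vertex]) auto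
  qed
qed

section \<open>Paths and distances of a spanning subforest inside the tree\<close>

locale spanning_subforest =
  fixes F T :: "'a wgraph"
  assumes tree: "is_tree T" and forest: "is_forest F"
    and sub: "weighted_subforest F T" and verts_eq: "verts F = verts T"
begin

lemma forest_T: "is_forest T"
  using tree by (simp add: is_tree_def)

lemma wf_T: "wf_wgraph T"
  using forest_T by (simp add: is_forest_def)

lemma path_T: "is_path F ps \<Longrightarrow> is_path T ps"
  using sub by (auto simp: is_path_def weighted_subforest_def)

lemma path_weight_T: "is_path F ps \<Longrightarrow> path_weight F ps = path_weight T ps"
  using sub by (auto simp: is_path_def path_weight_def weighted_subforest_def intro!: sum.cong)

lemma path_betw_T: "is_path_betw F x ps y \<Longrightarrow> is_path_betw T x ps y"
  by (auto simp: is_path_betw_def path_T)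

lemma component_path_T:
  assumes "K \<in> components F" "x \<in> K" "y \<in> K"
  obtains ps where "is_path_betw T x ps y" "set ps \<subseteq> K"
proof -
  obtain ps where "is_path_betw F x ps y" "set ps \<subseteq> K"
    using component_path[OF assms] .
  then show thesis using path_betw_T by (intro that)
qed

text \<open>One list serves all three graphs: the \<open>F\<close>-path from \<open>x\<close> to
  \<open>y\<close> stays in \<open>K\<close>, so it is also the path in the induced graph and in
  \<open>T\<close>, with the same weight. Uniqueness in the induced graph is inherited from
  \<open>F\<close>, since its paths are \<open>F\<close>-paths.\<close>

lemma comp_dist_eq_wdist:
  assumes K: "K \<in> components F" and "x \<in> K" "y \<in> K"
  shows "comp_dist F K x y = wdist T x y"
proof -
  let ?I = "induced F K"
  obtain ps where ps: "is_path_betw F x ps y" "set ps \<subseteq> K"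
    using component_path[OF assms] .
  then have psI: "is_path_betw ?I x ps y"
    using ps by (auto simp: is_path_betw_def is_path_def induced_def)
  have "K \<subseteq> verts F" using K Union_components[of F] by blast
  then have IF: "is_path_betw F x qs y" if "is_path_betw ?I x qs y" for qs
    using that by (auto simp: is_path_betw_def is_path_def induced_def)
  have "(THE qs. is_path_betw ?I x qs y) = ps"
    using psI forest_path_unique[OF forest IF ps(1)] by (rule the_equality)
  then have "comp_dist F K x y = path_weight F ps"
    by (simp add: comp_dist_def wdist_def path_weight_def induced_def)
  also have "\<dots> = path_weight T ps"
    using ps by (simp add: is_path_betw_def path_weight_T)
  also have "\<dots> = wdist T x y"
    using wdist_eq_path_weight[OF forest_T path_betw_T[OF ps(1)]] by simp
  finally show ?thesis .
qed

section \<open>Ports\<close>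

text \<open>The conditions on \<open>R\<close> mention only incidence with \<open>A\<close> and
  \<open>B\<close>, not weights. They turn out to make \<open>R\<close> the unique shortest joining
  path, which reduces the weight-based notion of port to finding such an \<open>R\<close>.\<close>

context
  fixes A B p q R
  assumes A: "A \<in> components F" and B: "B \<in> components F" and AB: "A \<noteq> B"
    and R: "is_path_betw T p R q" and RA: "set R \<inter> A = {p}" and RB: "set R \<inter> B = {q}"
begin

lemma wdist_via_ports:
  assumes "x \<in> A" "y \<in> B"
  shows "wdist T x y = wdist T x p + wdist T p q + wdist T q y"
proof -
  have disj: "A \<inter> B = {}" using A B AB by (rule components_disjoint)
  have "p \<in> A" "q \<in> B" using RA RB by auto
  obtain ps where ps: "is_path_betw T x ps p" "set ps \<subseteq> A"
    using component_path_T[OF A \<open>x \<in> A\<close> \<open>p \<in> A\<close>] .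
  obtain qs where qs: "is_path_betw T q qs y" "set qs \<subseteq> B"
    using component_path_T[OF B \<open>q \<in> B\<close> \<open>y \<in> B\<close>] .
  have "set ps \<inter> set R \<subseteq> {p}" using ps RA by auto
  note psR = is_path_betw_join[OF ps(1) R this]
  \<comment> \<open>\<open>ps\<close> lies in \<open>A\<close> and \<open>qs\<close> in
    \<open>B\<close>, which are disjoint, so only \<open>R\<close> can meet \<open>qs\<close>, and
    it does so only in \<open>q\<close>.\<close>
  have "set (ps @ tl R) \<inter> set qs \<subseteq> {q}"
    using psR(3) ps(2) qs(2) RB disj by auto
  note all = is_path_betw_join[OF psR(1) qs(1) this]
  show ?thesis
    using wdist_eq_path_weight[OF forest_T ps(1)] wdist_eq_path_weight[OF forest_T qs(1)]
      wdist_eq_path_weight[OF forest_T R] wdist_eq_path_weight[OF forest_T all(1)]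
      all(2) psR(2) by simp
qed

text \<open>By \<open>wdist_via_ports\<close> a competitor costs as much as \<open>R\<close> plus
  one detour inside \<open>A\<close> and one inside \<open>B\<close>. Without excess weight both
  detours vanish; positivity of the weights then makes its ends \<open>p\<close> and
  \<open>q\<close>, and path uniqueness finishes.\<close>

lemma joining_path_weight:
  assumes "joining_path T A B qs"
  shows "path_weight T R \<le> path_weight T qs"
    and "path_weight T qs \<le> path_weight T R \<Longrightarrow> qs = R"
proof -
  let ?x = "hd qs" and ?y = "last qs"
  have qs: "is_path_betw T ?x qs ?y" and xy: "?x \<in> A" "?y \<in> B"
    using assms by (auto simp: joining_path_def is_path_betw_def)
  have pq: "p \<in> A" "q \<in> B" using RA RB by auto
  have eq: "path_weight T qs = wdist T ?x p + path_weight T R + wdist T q ?y"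
    using wdist_via_ports[OF xy] wdist_eq_path_weight[OF forest_T qs]
      wdist_eq_path_weight[OF forest_T R] by simp
  then show "path_weight T R \<le> path_weight T qs" by simp
  have zero: "u = v" if uv: "wdist T u v = 0" and C: "C \<in> components F" "u \<in> C" "v \<in> C" for u v C
  proof -
    obtain ps where ps: "is_path_betw T u ps v"
      using component_path_T[OF C] .
    then show ?thesis
      using uv path_weight_pos[OF wf_T ps] wdist_eq_path_weight[OF forest_T ps] by auto
  qed
  assume "path_weight T qs \<le> path_weight T R"
  then have "wdist T ?x p = 0" "wdist T q ?y = 0" using eq by auto
  then have "?x = p" "q = ?y"
    using zero[OF _ A xy(1) pq(1)] zero[OF _ B pq(2) xy(2)] by simp_all
  then show "qs = R"
    using forest_path_unique[OF forest_T _ R] qs by simp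
qed

lemma shortest_joining_path_iff: "shortest_joining_path T A B qs \<longleftrightarrow> qs = R"
proof -
  have "joining_path T A B R"
    using R RA RB by (auto simp: joining_path_def is_path_betw_def)
  then show ?thesis
    using joining_path_weight by (auto simp: shortest_joining_path_def)
qed

lemma is_port_hd: "is_port T A B p"
  using R by (auto simp: is_port_def shortest_joining_path_iff is_path_betw_def)

end

text \<open>A joining path with the fewest vertices is chosen, minimising length rather than weight.
  Any further vertex in \<open>A\<close> or in \<open>B\<close> would allow the part before or after
  it to be cut off, giving a shorter joining path.\<close>

lemma connecting_path_exists:
  assumes A: "A \<in> components F" and B: "B \<in> components F"
  obtains p q R where "is_path_betw T p R q" "set R \<inter> A = {p}" "set R \<inter> B = {q}"
proof -
  obtain a b where ab: "a \<in> A" "b \<in> B"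
    using component_nonempty[OF A] component_nonempty[OF B] by blast
  then have "a \<in> verts T" "b \<in> verts T"
    using A B Union_components[of F] verts_eq by auto
  then obtain R0 where "is_path_betw T a R0 b"
    using tree by (auto simp: is_tree_def is_connected_def)
  then have "joining_path T A B R0"
    using ab by (auto simp: joining_path_def is_path_betw_def)
  then obtain R where R: "joining_path T A B R"
    and min: "\<And>S. joining_path T A B S \<Longrightarrow> length R \<le> length S"
    using ex_has_least_nat[of "joining_path T A B" R0 length] by metis
  let ?p = "hd R" and ?q = "last R"
  have betw: "is_path_betw T ?p R ?q" and mem: "?p \<in> A" "?q \<in> B"
    using R by (auto simp: joining_path_def is_path_betw_def)
  have "w = ?p" if w: "w \<in> set R" "w \<in> A" for w
  proof -
    obtain us vs where s: "R = us @ w # vs" using w(1) by (meson split_list)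
    have "is_path_betw T w (w # vs) ?q"
      using is_path_betw_appendD(2)[OF betw[unfolded s]] by (simp add: s)
    then have "length R \<le> length (w # vs)"
      using w(2) mem by (intro min) (simp add: joining_path_def is_path_betw_def)
    then have "us = []" by (simp add: s)
    then show ?thesis by (simp add: s)
  qed
  moreover have "w = ?q" if w: "w \<in> set R" "w \<in> B" for w
  proof -
    obtain us vs where s: "R = us @ w # vs" using w(1) by (meson split_list)
    have "is_path_betw T ?p (us @ [w]) w"
      using is_path_betw_appendD(1)[OF betw[unfolded s]] by (simp add: s)
    then have "length R \<le> length (us @ [w])"
      using w(2) mem by (intro min) (simp add: joining_path_def is_path_betw_def)
    then have "vs = []" by (simp add: s)
    then show ?thesis by (simp add: s)
  qed
  ultimately have "set R \<inter> A = {?p}" "set R \<inter> B = {?q}"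
    using mem is_path_betw_ends(2,3)[OF betw] by blast+
  then show thesis by (rule that[OF betw])
qed

text \<open>One path supplies both ports and the route contribution. Writing the block as the image
  of \<open>A \<times> B\<close> under the tree distance reduces later claims about blocks to claims
  about vertex pairs.\<close>

lemma ports_exist:
  assumes A: "A \<in> components F" and B: "B \<in> components F" and "A \<noteq> B"
  shows "\<exists>p q. p \<in> A \<and> q \<in> B \<and> is_port T A B p \<and> is_port T B A q \<and> wdist T p q \<ge> 1 \<and>
    block F A B p (wdist T p q) q = (\<lambda>(x, y). wdist T x y) ` (A \<times> B)"
proof -
  obtain p q R where R: "is_path_betw T p R q" "set R \<inter> A = {p}" "set R \<inter> B = {q}"
    using connecting_path_exists[OF A B] .
  have pq: "p \<in> A" "q \<in> B" using R by auto
  have port_A: "is_port T A B p"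
    using is_port_hd[OF A B \<open>A \<noteq> B\<close> R] .
  \<comment> \<open>The reversed path satisfies the same conditions with \<open>A\<close> and
    \<open>B\<close> exchanged.\<close>
  have port_B: "is_port T B A q"
    using R by (intro is_port_hd[OF B A \<open>A \<noteq> B\<close>[symmetric] is_path_betw_rev[OF R(1)]]) auto
  have "p \<noteq> q"
    using pq components_disjoint[OF assms] by auto
  then have pos: "wdist T p q \<ge> 1"
    using path_weight_pos[OF wf_T R(1)] wdist_eq_path_weight[OF forest_T R(1)] by simp
  have dist: "comp_dist F A x p + wdist T p q + comp_dist F B q y = wdist T x y"
    if "x \<in> A" "y \<in> B" for x y
    using wdist_via_ports[OF assms R that] comp_dist_eq_wdist[OF A that(1) pq(1)]
      comp_dist_eq_wdist[OF B pq(2) that(2)] by simp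
  have "block F A B p (wdist T p q) q =
      (\<lambda>(x, y). comp_dist F A x p + wdist T p q + comp_dist F B q y) ` (A \<times> B)"
    by (auto simp: block_def image_def Bex_def)
  also have "\<dots> = (\<lambda>(x, y). wdist T x y) ` (A \<times> B)"
    by (rule image_cong) (auto simp: dist)
  finally have block: "block F A B p (wdist T p q) q = (\<lambda>(x, y). wdist T x y) ` (A \<times> B)" .
  show ?thesis
    by (intro exI[of _ p] exI[of _ q] conjI pq port_A port_B pos block)
qed

end

section \<open>The blocks as a partition of the unfilled values\<close>

theorem theorem4p1:
  fixes T F :: "'a wgraph" and n m :: nat and K :: "nat \<Rightarrow> 'a set"
  assumes leech: "leech_tree n T"
    and valid: "valid_prefix_forest_on (verts T) F"
    and sub: "weighted_subforest F T"
    and comps: "bij_betw K {1..m} (components F)"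
  shows "\<exists>(p :: nat \<Rightarrow> nat \<Rightarrow> 'a) (L :: nat \<Rightarrow> nat \<Rightarrow> nat).
    (\<forall>i j. 1 \<le> i \<and> i < j \<and> j \<le> m \<longrightarrow>
       p i j \<in> K i \<and> p j i \<in> K j \<and>
       is_port T (K i) (K j) (p i j) \<and> is_port T (K j) (K i) (p j i) \<and>
       L i j = wdist T (p i j) (p j i) \<and> L i j \<ge> 1) \<and>
    (let B = (\<lambda>(i, j). block F (K i) (K j) (p i j) (L i j) (p j i));
         P = {(i, j). 1 \<le> i \<and> i < j \<and> j \<le> m}
     in (\<forall>(i, j)\<in>P. card (B (i, j)) = card (K i) * card (K j)) \<and>
        (\<forall>ij\<in>P. B ij \<subseteq> unfilled F) \<and>
        disjoint_family_on B P \<and>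
        (\<Union>ij\<in>P. B ij) = unfilled F)"
proof -
  interpret spanning_subforest F T
    using leech valid sub
    by unfold_locales (auto simp: leech_tree_def valid_prefix_forest_on_def prefix_forest_on_def)
  let ?P = "{(i, j). 1 \<le> i \<and> i < j \<and> j \<le> m}"
  let ?d = "\<lambda>(x, y). wdist T x y"
  have card_verts: "card (verts F) = n"
    using leech verts_eq by (simp add: leech_tree_def)
  have K: "K i \<in> components F" if "i \<in> {1..m}" for i
    using bij_betw_apply[OF comps that] .
  have K_verts: "K i \<subseteq> verts T" if "i \<in> {1..m}" for i
    using Union_upper[OF K[OF that]] by (simp add: Union_components verts_eq)
  have K_neq: "K i \<noteq> K j" if "i \<in> {1..m}" "j \<in> {1..m}" "i \<noteq> j" for i j
    using inj_onD[OF bij_betw_imp_inj_on[OF comps] _ that(1,2)] that(3) by blast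
  have same: "i = j" if "x \<in> K i" "x \<in> K j" "i \<in> {1..m}" "j \<in> {1..m}" for i j x
  proof (rule ccontr)
    assume "i \<noteq> j"
    then have "K i \<inter> K j = {}"
      using components_disjoint[OF K K K_neq] that(3,4) by simp
    then show False using that(1,2) by auto
  qed
  have dist_eqD: "{x, y} = {x', y'}"
    if "wdist T x y = wdist T x' y'" "x \<noteq> y" "x' \<noteq> y'"
      "x \<in> verts T" "y \<in> verts T" "x' \<in> verts T" "y' \<in> verts T" for x y x' y'
    using leech[unfolded leech_tree_def, THEN conjunct2, THEN conjunct2, THEN conjunct2,
        THEN bspec, OF that(4), THEN bspec, OF that(5), THEN bspec, OF that(6),
        THEN bspec, OF that(7)] that(1-3) by simp
  have dist_range: "{wdist T x y | x y. x \<in> verts T \<and> y \<in> verts T \<and> x \<noteq> y} = value_range n"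
    using leech by (simp add: leech_tree_def)
  \<comment> \<open>This serves both (i) and (iii): with equal index pairs it is injectivity on one
    product, with different ones disjointness of blocks. The Leech property determines only the
    unordered vertex pair; the swapped case contradicts \<open>i < j\<close> and
    \<open>i' < j'\<close>.\<close>
  have cross: "(i, j) = (i', j') \<and> (x, y) = (x', y')"
    if "wdist T x y = wdist T x' y'" "(i, j) \<in> ?P" "(i', j') \<in> ?P"
      "x \<in> K i" "y \<in> K j" "x' \<in> K i'" "y' \<in> K j'" for i j i' j' x y x' y'
  proof -
    have ind: "i \<in> {1..m}" "j \<in> {1..m}" "i' \<in> {1..m}" "j' \<in> {1..m}" "i < j" "i' < j'"
      using that by auto
    have "x \<noteq> y" "x' \<noteq> y'"
      using same[OF that(4) _ ind(1,2)] same[OF that(6) _ ind(3,4)] that(5,7) ind(5,6) by auto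
    moreover have "x \<in> verts T" "y \<in> verts T" "x' \<in> verts T" "y' \<in> verts T"
      using K_verts ind(1-4) that(4-7) by auto
    ultimately have "{x, y} = {x', y'}"
      by (intro dist_eqD that(1))
    then consider "x = x'" "y = y'" | "x = y'" "y = x'" by (auto simp: doubleton_eq_iff)
    then show ?thesis
    proof cases
      case 1
      then have "i = i'" "j = j'"
        using same[OF that(4) _ ind(1,3)] same[OF that(5) _ ind(2,4)] that(6,7) by simp_all
      then show ?thesis using 1 by simp
    next
      case 2
      then have "i = j'" "j = i'"
        using same[OF that(4) _ ind(1,4)] same[OF that(5) _ ind(2,3)] that(6,7) by simp_all
      then show ?thesis using ind by simp
    qed
  qed
  define good where "good i j p q \<longleftrightarrow>
      p \<in> K i \<and> q \<in> K j \<and> is_port T (K i) (K j) p \<and> is_port T (K j) (K i) q \<and> wdist T p q \<ge> 1 \<and>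
      block F (K i) (K j) p (wdist T p q) q = ?d ` (K i \<times> K j)" for i j p q
  \<comment> \<open>Both ports are chosen together as one pair, since \<open>good\<close> relates
    them through their distance and the block.\<close>
  define pq where "pq i j = (SOME pq. good i j (fst pq) (snd pq))" for i j
  have good_pq: "good i j (fst (pq i j)) (snd (pq i j))" if "(i, j) \<in> ?P" for i j
  proof -
    have ij: "i \<in> {1..m}" "j \<in> {1..m}" "i \<noteq> j" using that by auto
    obtain p q where "good i j p q"
      unfolding good_def
      using ports_exist[OF K[OF ij(1)] K[OF ij(2)] K_neq[OF ij]] by blast
    then have "good i j (fst (p, q)) (snd (p, q))" by simp
    then show ?thesis unfolding pq_def by (rule someI)
  qed
  \<comment> \<open>Both directions read from the choice made for the increasing index pair; the
    value on the diagonal is arbitrary.\<close>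
  define p where "p i j = (if i < j then fst (pq i j) else snd (pq j i))" for i j
  define L where "L i j = wdist T (p i j) (p j i)" for i j
  have ports: "p i j \<in> K i \<and> p j i \<in> K j \<and>
       is_port T (K i) (K j) (p i j) \<and> is_port T (K j) (K i) (p j i) \<and>
       L i j = wdist T (p i j) (p j i) \<and> L i j \<ge> 1 \<and>
       block F (K i) (K j) (p i j) (L i j) (p j i) = ?d ` (K i \<times> K j)"
    if "(i, j) \<in> ?P" for i j
  proof -
    have "p i j = fst (pq i j)" "p j i = snd (pq i j)" using that by (auto simp: p_def)
    then show ?thesis
      using good_pq[OF that] unfolding good_def L_def by simp
  qed
  define B where "B = (\<lambda>(i, j). block F (K i) (K j) (p i j) (L i j) (p j i))"
  have B: "B (i, j) = ?d ` (K i \<times> K j)" if "(i, j) \<in> ?P" for i j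
    using ports[OF that] unfolding B_def prod.case by blast
  have card_B: "card (B (i, j)) = card (K i) * card (K j)" if "(i, j) \<in> ?P" for i j
  proof -
    have "inj_on ?d (K i \<times> K j)"
    proof (rule inj_onI)
      fix a b assume "a \<in> K i \<times> K j" "b \<in> K i \<times> K j" "?d a = ?d b"
      then show "a = b"
        using cross[OF _ that that, of "fst a" "snd a" "fst b" "snd b"]
        by (auto simp: mem_Times_iff split_beta prod_eq_iff)
    qed
    then show ?thesis
      using B[OF that] by (simp add: card_image card_cartesian_product)
  qed
  have B_subset: "B (i, j) \<subseteq> unfilled F" if ij: "(i, j) \<in> ?P" for i j
  proof
    fix v assume "v \<in> B (i, j)"
    then obtain x y where xy: "x \<in> K i" "y \<in> K j" "v = wdist T x y"
      using B[OF ij] by auto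
    have ind: "i \<in> {1..m}" "j \<in> {1..m}" "i \<noteq> j" using ij by auto
    have disj: "K i \<inter> K j = {}"
      using components_disjoint[OF K K K_neq] ind by simp
    then have neq: "x \<noteq> y" using xy by auto
    have V: "x \<in> verts T" "y \<in> verts T" using xy K_verts ind by auto
    \<comment> \<open>An internal distance is also a tree distance, so the Leech property would
      identify its vertex pair with \<open>{x, y}\<close> and put \<open>x\<close> and
      \<open>y\<close> in one component.\<close>
    have "v \<notin> internal_distances F"
    proof
      assume "v \<in> internal_distances F"
      then obtain C x' y' where C: "C \<in> components F" "x' \<in> C" "y' \<in> C" "x' \<noteq> y'"
        "v = comp_dist F C x' y'"
        by (auto simp: internal_distances_def)
      then have "{x, y} = {x', y'}"
        using xy(3) neq V Union_components[of F] verts_eq comp_dist_eq_wdist[OF C(1-3)]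
        by (intro dist_eqD) auto
      then have "x \<in> C" "y \<in> C" using C by auto
      then have "K i \<inter> C \<noteq> {}" "K j \<inter> C \<noteq> {}"
        using xy by auto
      then have "K i = C" "K j = C"
        using components_disjoint[OF K[OF ind(1)] C(1)] components_disjoint[OF K[OF ind(2)] C(1)]
        by argo+
      then show False using K_neq[OF ind] by simp
    qed
    moreover have "v \<in> value_range n"
      unfolding dist_range[symmetric] using xy(3) V neq by blast
    ultimately show "v \<in> unfilled F"
      by (simp add: unfilled_def card_verts)
  qed
  have "disjoint_family_on B ?P"
    unfolding disjoint_family_on_def
  proof (intro ballI impI)
    fix a b assume ab: "a \<in> ?P" "b \<in> ?P" "a \<noteq> b"
    obtain i j i' j' where eq: "a = (i, j)" "b = (i', j')" by (cases a, cases b)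
    show "B a \<inter> B b = {}"
    proof (rule ccontr)
      assume "B a \<inter> B b \<noteq> {}"
      then obtain x y x' y' where "x \<in> K i" "y \<in> K j" "x' \<in> K i'" "y' \<in> K j'"
        "wdist T x y = wdist T x' y'"
        unfolding eq B[OF ab(1)[unfolded eq]] B[OF ab(2)[unfolded eq]] by auto
      then show False
        using cross[OF _ ab(1,2)[unfolded eq]] ab(3) eq by simp
    qed
  qed
  moreover have "unfilled F \<subseteq> (\<Union>ij\<in>?P. B ij)"
  proof
    fix v assume v: "v \<in> unfilled F"
    then have "v \<in> value_range n" by (simp add: unfilled_def card_verts)
    then obtain x y where xy: "x \<in> verts T" "y \<in> verts T" "x \<noteq> y" "v = wdist T x y"
      unfolding dist_range[symmetric] by blast
    have "\<Union>(K ` {1..m}) = verts T"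
      using comps Union_components[of F] verts_eq by (simp add: bij_betw_def)
    then obtain i j where ij: "i \<in> {1..m}" "x \<in> K i" "j \<in> {1..m}" "y \<in> K j"
      using xy by blast
    \<comment> \<open>Two vertices of one component would make \<open>v\<close> an internal
      distance, hence filled.\<close>
    have "i \<noteq> j"
    proof
      assume "i = j"
      then have "v = comp_dist F (K i) x y" "y \<in> K i"
        using ij xy(4) comp_dist_eq_wdist[OF K[OF ij(1)], of x y] by simp_all
      then have "v \<in> internal_distances F"
        using K[OF ij(1)] ij(2) xy(3) unfolding internal_distances_def by blast
      then show False using v by (simp add: unfilled_def)
    qed
    \<comment> \<open>The pair realising \<open>v\<close> comes in no particular index order; if its
      indices decrease, symmetry of the distance places \<open>v\<close> in the block of the
      reversed pair.\<close>
    then consider "(i, j) \<in> ?P" | "(j, i) \<in> ?P" using ij by fastforce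
    then show "v \<in> (\<Union>ij\<in>?P. B ij)"
    proof cases
      case 1
      then have "v \<in> B (i, j)" using B[OF 1] xy ij by auto
      then show ?thesis using 1 by blast
    next
      case 2
      then have "v \<in> B (j, i)" using B[OF 2] xy ij wdist_commute[OF tree xy(1,2)] by auto
      then show ?thesis using 2 by blast
    qed
  qed
  moreover have "(\<Union>ij\<in>?P. B ij) \<subseteq> unfilled F"
    using B_subset by (intro UN_least) auto
  ultimately have "disjoint_family_on B ?P" "(\<Union>ij\<in>?P. B ij) = unfilled F"
    by (simp_all only: antisym)
  moreover have "\<forall>(i, j)\<in>?P. card (B (i, j)) = card (K i) * card (K j)"
    using card_B by auto
  moreover have "\<forall>ij\<in>?P. B ij \<subseteq> unfilled F"
    using B_subset by auto
  moreover have "\<forall>i j. 1 \<le> i \<and> i < j \<and> j \<le> m \<longrightarrow>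
       p i j \<in> K i \<and> p j i \<in> K j \<and>
       is_port T (K i) (K j) (p i j) \<and> is_port T (K j) (K i) (p j i) \<and>
       L i j = wdist T (p i j) (p j i) \<and> L i j \<ge> 1"
    using ports by blast
  ultimately show ?thesis
    unfolding Let_def B_def by (intro exI[of _ p] exI[of _ L] conjI)
qed

end
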